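(* Let $p(u)=\sum_{i=0}^n a_i u^i$ be a univariate polynomial with coefficients $a_i\ge 0$, and define the convex function $\Phi\colon\mathbb{R}^d\to\mathbb{R}$, $$\Phi(x) = \sum_{i=0}^n a_i\left(\frac{3i + 7}{i+2} \right)\|x\|_2^{i+2}.$$ Then for all $x, y \in \mathbb{R}^d$, we have $$D_{\Phi}(y, x) \geq \frac{p(\|x\|_2)+p(\|y\|_2)}{2} \cdot \|x - y\|_2^2.$$ Consequently, if $f_x(\cdot,\xi)\colon\mathbb{R}^d\to\mathbb{R}$ ($x\in\mathbb{R}^d$, $\xi\in\Omega$) is a family of functions and $L\colon\Omega\to\mathbb{R}_+$ satisfies $$\frac{f_{x}(x, \xi) - f_{x}(y, \xi)}{\|x-y\|_2} \leq L(\xi) \sqrt{\frac{p(\|x\|_2)+p(\|y\|_2)}{2}} \qquad \text{for all distinct } x,y\in\mathbb{R}^d,$$ then $f_x(x,\xi)-f_x(y,\xi)\le L(\xi)\sqrt{D_\Phi(y,x)}$ for all $x,y\in\mathbb{R}^d$.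
   Context: $\|\cdot\|_2$ is the Euclidean norm on $\mathbb{R}^d$, and $D_\Phi(y,x)=\Phi(y)-\Phi(x)-\langle\nabla\Phi(x),y-x\rangle$ is the Bregman divergence of the differentiable function $\Phi$. $\Omega$ is the index set (sample space) of the stochastic models. *)

theory Defs
  imports "HOL-Analysis.Analysis" "HOL-Computational_Algebra.Polynomial"
begin

definition gradient :: "('a::real_inner \<Rightarrow> real) \<Rightarrow> 'a \<Rightarrow> 'a" where
  "gradient f x = (THE D. GDERIV f x :> D)"

lemma gradient_eqI:
  fixes f :: "'a::real_inner \<Rightarrow> real"
  assumes "GDERIV f x :> D"
  shows "gradient f x = D"
  unfolding gradient_def
proof (rule the_equality)
  show "GDERIV f x :> D" by fact
next
  fix E assume "GDERIV f x :> E"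
  with assms have "(\<lambda>h. h \<bullet> E) = (\<lambda>h. h \<bullet> D)"
    unfolding gderiv_def by (rule has_derivative_unique[rotated])
  then have "\<forall>h. h \<bullet> E = h \<bullet> D" by metis
  then show "E = D" by (simp only: vector_eq_ldot)
qed

text \<open>The argument order follows the notation \<open>D\<^sub>\<Phi>(y, x)\<close>: the gradient is taken at the
  second point. Meaningful only where \<open>\<Phi>\<close> is differentiable.\<close>

definition bregman :: "('a::real_inner \<Rightarrow> real) \<Rightarrow> 'a \<Rightarrow> 'a \<Rightarrow> real" where
  "bregman \<Phi> y x = \<Phi> y - \<Phi> x - gradient \<Phi> x \<bullet> (y - x)"

end

theory Submission
  imports Defs
begin

text \<open>
  Both sides of the divergence bound are linear in the coefficients \<open>a i\<close>, so by
  \<open>a i \<ge> 0\<close> it suffices to treat a single power \<open>x \<mapsto> norm x ^ (i + 2)\<close> with weight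
  \<open>(3 * i + 7) / (i + 2)\<close>. This weight is at least \<open>3\<close>; the lemma
  \<open>norm_power_divergence_ge\<close> shows that weight \<open>2\<close> is enough.

  For a single power, with \<open>r = norm x\<close> and \<open>s = norm y\<close> fixed, the divergence and the
  squared distance depend on the angle between \<open>x\<close> and \<open>y\<close> only through \<open>x \<bullet> y\<close>, and
  both are affine in it. By Cauchy-Schwarz \<open>x \<bullet> y\<close> lies between \<open>- r * s\<close> and \<open>r * s\<close>, so
  only the two endpoints, where \<open>x\<close> and \<open>y\<close> are collinear, have to be checked. If they
  point in the same direction, the divergence is the remainder of the tangent to
  \<open>u \<mapsto> u ^ (i + 2)\<close>, which is \<open>(s - r)\<^sup>2\<close> times a sum of monomials containing both \<open>s ^ i\<close>
  and \<open>r ^ i\<close> (lemma \<open>power_tangent_gap_ge\<close>). If they point in opposite directions, the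
  divergence is at least \<open>r ^ (i + 2) + s ^ (i + 2)\<close>, and the factor \<open>2\<close> makes this
  dominate \<open>(r ^ i + s ^ i) / 2 * (r + s)\<^sup>2\<close> (lemma \<open>power_mean_product_le\<close>).

  The bound makes the divergence nonnegative, so the graph of \<open>\<Phi>\<close> lies above its tangents
  and \<open>\<Phi>\<close> is convex. The last claim is the bound after taking square roots.
\<close>

text \<open>The gap is \<open>(s - r)\<^sup>2 * (\<Sum>j\<le>i. (j + 1) * r ^ j * s ^ (i - j))\<close>, and the extreme terms of
  the sum are at least \<open>s ^ i\<close> and \<open>r ^ i\<close>. The induction is the recursion that this sum
  satisfies in \<open>i\<close>.\<close>

lemma power_tangent_gap_ge:
  fixes r s :: real
  assumes "r \<ge> 0" "s \<ge> 0"
  shows "(r ^ i + s ^ i) / 2 * (s - r)\<^sup>2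
    \<le> s ^ (i + 2) - r ^ (i + 2) - (real i + 2) * r ^ (i + 1) * (s - r)"
proof (induction i)
  case 0
  show ?case by (simp add: power2_eq_square algebra_simps)
next
  case (Suc i)
  have "(r ^ Suc i + s ^ Suc i) / 2 \<le> s * ((r ^ i + s ^ i) / 2) + (real i + 2) * r ^ Suc i"
  proof -
    have "0 \<le> s * r ^ i" "0 \<le> r ^ Suc i" "0 \<le> real i * r ^ Suc i" using assms by simp_all
    then show ?thesis by (simp add: algebra_simps add_divide_distrib)
  qed
  then have "(r ^ Suc i + s ^ Suc i) / 2 * (s - r)\<^sup>2
      \<le> (s * ((r ^ i + s ^ i) / 2) + (real i + 2) * r ^ Suc i) * (s - r)\<^sup>2"
    by (intro mult_right_mono) auto
  also have "\<dots> = s * ((r ^ i + s ^ i) / 2 * (s - r)\<^sup>2) + (real i + 2) * r ^ Suc i * (s - r)\<^sup>2"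
    by (simp add: algebra_simps)
  also have "\<dots> \<le> s * (s ^ (i + 2) - r ^ (i + 2) - (real i + 2) * r ^ (i + 1) * (s - r))
      + (real i + 2) * r ^ Suc i * (s - r)\<^sup>2"
    by (intro add_right_mono mult_left_mono Suc.IH assms)
  also have "\<dots> = s ^ (Suc i + 2) - r ^ (Suc i + 2) - (real (Suc i) + 2) * r ^ (Suc i + 1) * (s - r)"
    by (simp add: algebra_simps power2_eq_square)
  finally show ?case .
qed

text \<open>Bound \<open>(r + s)\<^sup>2\<close> by \<open>2 * (r\<^sup>2 + s\<^sup>2)\<close>; the rest is Chebyshev's inequality for the similarly
  ordered pairs \<open>(r ^ i, s ^ i)\<close> and \<open>(r\<^sup>2, s\<^sup>2)\<close>.\<close>

lemma power_mean_product_le: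
  fixes r s :: real
  assumes "r \<ge> 0" "s \<ge> 0"
  shows "(r ^ i + s ^ i) / 2 * (r + s)\<^sup>2 \<le> 2 * (r ^ (i + 2) + s ^ (i + 2))"
proof -
  have "0 \<le> (r ^ i - s ^ i) * (r\<^sup>2 - s\<^sup>2)"
  proof (cases "r \<le> s")
    case True
    then show ?thesis using assms by (intro mult_nonpos_nonpos) (simp_all add: power_mono)
  next
    case False
    then show ?thesis using assms by (intro mult_nonneg_nonneg) (simp_all add: power_mono)
  qed
  then have "(r ^ i + s ^ i) * (r\<^sup>2 + s\<^sup>2) \<le> 2 * (r ^ (i + 2) + s ^ (i + 2))"
    by (simp add: algebra_simps power2_eq_square)
  moreover have "(r + s)\<^sup>2 \<le> 2 * (r\<^sup>2 + s\<^sup>2)"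
    using sum_squares_bound[of r s] by (simp add: power2_sum)
  then have "(r ^ i + s ^ i) / 2 * (r + s)\<^sup>2 \<le> (r ^ i + s ^ i) / 2 * (2 * (r\<^sup>2 + s\<^sup>2))"
    using assms by (intro mult_left_mono) auto
  moreover have "(r ^ i + s ^ i) / 2 * (2 * (r\<^sup>2 + s\<^sup>2)) = (r ^ i + s ^ i) * (r\<^sup>2 + s\<^sup>2)"
    by (simp add: field_simps)
  ultimately show ?thesis by linarith
qed

lemma affine_nonneg_between:
  fixes A B u m :: real
  assumes "0 \<le> u" "u \<le> m" and "0 \<le> A" "0 \<le> A + B * m"
  shows "0 \<le> A + B * u"
proof (cases "B \<ge> 0")
  case True
  then show ?thesis using assms by simp
next
  case False
  then have "B * m \<le> B * u" using assms by (intro mult_left_mono_neg) auto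
  then show ?thesis using assms by linarith
qed

text \<open>The parameter \<open>u\<close> measures how far \<open>x\<close> and \<open>y\<close> are from pointing in the same direction;
  everything is affine in \<open>u\<close>, which ranges over \<open>[0, 2 * r * s]\<close>.\<close>

lemma norm_power_divergence_ge:
  fixes x y :: "'a::real_inner"
  assumes "c \<ge> 2"
  shows "(norm x ^ i + norm y ^ i) / 2 * (norm (x - y))\<^sup>2
    \<le> c * (norm y ^ (i + 2) - norm x ^ (i + 2) - (real i + 2) * norm x ^ i * (x \<bullet> (y - x)))"
proof -
  define r s u where "r = norm x" and "s = norm y" and "u = norm x * norm y - x \<bullet> y"
  define M where "M = (r ^ i + s ^ i) / 2"
  define F where "F = s ^ (i + 2) - r ^ (i + 2) - (real i + 2) * r ^ (i + 1) * (s - r)"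
  define D where "D = F + (real i + 2) * r ^ i * u"
  have r: "r \<ge> 0" and s: "s \<ge> 0" by (simp_all add: r_def s_def)
  have u: "0 \<le> u" "u \<le> 2 * r * s"
    using Cauchy_Schwarz_ineq2[of x y] by (auto simp: u_def r_def s_def abs_le_iff)
  have M: "M \<ge> 0" using r s by (simp add: M_def)
  have F: "M * (s - r)\<^sup>2 \<le> F"
    unfolding M_def F_def using power_tangent_gap_ge[OF r s] .
  then have F0: "0 \<le> F" using M by (meson mult_nonneg_nonneg order_trans zero_le_power2)
  \<comment> \<open>At \<open>u = 2 * r * s\<close> the divergence is \<open>s ^ (i + 2) + (i + 1) * r ^ (i + 2)\<close> plus a nonnegative
    mixed term.\<close>
  have opposite: "M * (r + s)\<^sup>2 \<le> 2 * (F + (real i + 2) * r ^ i * (2 * r * s))"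
  proof -
    have "0 \<le> real i * r ^ (i + 2)" "0 \<le> (real i + 2) * r ^ (i + 1) * s" using r s by simp_all
    then have "2 * (r ^ (i + 2) + s ^ (i + 2)) \<le> 2 * (F + (real i + 2) * r ^ i * (2 * r * s))"
      unfolding F_def by (simp add: algebra_simps)
    then show ?thesis
      unfolding M_def using power_mean_product_le[OF r s, of i] by linarith
  qed
  \<comment> \<open>Since \<open>D \<ge> 0\<close>, the case \<open>c = 2\<close> implies the others.\<close>
  have "0 \<le> (2 * F - M * (s - r)\<^sup>2) + (2 * (real i + 2) * r ^ i - 2 * M) * u"
  proof (rule affine_nonneg_between[OF u])
    show "0 \<le> 2 * F - M * (s - r)\<^sup>2" using F F0 by linarith
    show "0 \<le> (2 * F - M * (s - r)\<^sup>2) + (2 * (real i + 2) * r ^ i - 2 * M) * (2 * r * s)"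
      using opposite by (simp add: algebra_simps power2_eq_square)
  qed
  then have "M * ((s - r)\<^sup>2 + 2 * u) \<le> 2 * D"
    unfolding D_def by (simp add: algebra_simps)
  also have "\<dots> \<le> c * D"
    using assms F0 u r unfolding D_def by (intro mult_right_mono) auto
  also have "(s - r)\<^sup>2 + 2 * u = (norm (x - y))\<^sup>2"
    unfolding r_def s_def u_def power2_norm_eq_inner
    by (simp add: power2_diff power2_norm_eq_inner inner_diff inner_commute)
  also have "D = norm y ^ (i + 2) - norm x ^ (i + 2) - (real i + 2) * norm x ^ i * (x \<bullet> (y - x))"
  proof -
    have "r * (s - r) = u + x \<bullet> (y - x)"
      by (simp add: r_def s_def u_def inner_diff_right right_diff_distrib
          flip: power2_norm_eq_inner power2_eq_square)
    then have "(real i + 2) * r ^ (i + 1) * (s - r) = (real i + 2) * r ^ i * (u + x \<bullet> (y - x))"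
      by (simp flip: mult.assoc)
    then show ?thesis
      unfolding D_def F_def r_def[symmetric] s_def[symmetric] by (simp only: distrib_left)
  qed
  finally show ?thesis unfolding M_def r_def s_def .
qed

text \<open>The exponent is written \<open>i + 2\<close> because powers above \<open>1\<close> are differentiable at the origin
  too, although the norm is not.\<close>

lemma GDERIV_norm_power:
  fixes x :: "'a::real_inner"
  shows "GDERIV (\<lambda>x. norm x ^ (i + 2)) x :> ((real i + 2) * norm x ^ i) *\<^sub>R x"
proof (cases "x = 0")
  case True
  have "((\<lambda>h::'a. norm h ^ (i + 1)) \<longlongrightarrow> norm (0::'a) ^ (i + 1)) (at 0)"
    by (intro tendsto_intros)
  moreover have "\<forall>\<^sub>F h::'a in at 0. norm h ^ (i + 1) = norm (norm h ^ (i + 2)) / norm h"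
    by (auto simp: eventually_at_filter)
  ultimately have "((\<lambda>h::'a. norm (norm h ^ (i + 2)) / norm h) \<longlongrightarrow> 0) (at 0)"
    by (simp add: tendsto_cong)
  then have "((\<lambda>x::'a. norm x ^ (i + 2)) has_derivative (\<lambda>h. 0)) (at 0)"
    by (simp add: has_derivative_at)
  then show ?thesis using True by (simp add: gderiv_def)
next
  case False
  have "DERIV (\<lambda>u. u ^ (i + 2)) (norm x) :> (real i + 2) * norm x ^ (i + 1)"
    using DERIV_pow[of "i + 2" "norm x"] by (simp add: add.commute)
  with GDERIV_norm[OF False] have
    "GDERIV (\<lambda>x. norm x ^ (i + 2)) x :> ((real i + 2) * norm x ^ (i + 1)) *\<^sub>R sgn x"
    by (rule GDERIV_DERIV_compose)
  then show ?thesis using False by (simp add: sgn_div_norm flip: divide_inverse)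
qed

lemma GDERIV_sum:
  assumes "\<And>i. i \<in> I \<Longrightarrow> GDERIV (f i) x :> g i"
  shows "GDERIV (\<lambda>x. \<Sum>i\<in>I. f i x) x :> (\<Sum>i\<in>I. g i)"
  using assms unfolding gderiv_def inner_sum_right by (intro has_derivative_sum)

text \<open>The minorant that touches \<open>F\<close> at an intermediate point \<open>z\<close> of a segment, averaged over the
  two ends, takes the value \<open>F z\<close>, since its linear part cancels.\<close>

lemma convex_on_UNIV_if_above_tangents:
  fixes F :: "'a::real_inner \<Rightarrow> real"
  assumes "\<And>x y. F y \<ge> F x + g x \<bullet> (y - x)"
  shows "convex_on UNIV F"
proof (rule convex_onI)
  fix t :: real and x y :: 'a
  assume t: "0 < t" "t < 1"
  define z where "z = (1 - t) *\<^sub>R x + t *\<^sub>R y"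
  have "(1 - t) *\<^sub>R (x - z) + t *\<^sub>R (y - z) = 0"
    by (simp add: z_def algebra_simps)
  then have "(1 - t) * (g z \<bullet> (x - z)) + t * (g z \<bullet> (y - z)) = 0"
    by (metis inner_add_right inner_scaleR_right inner_zero_right)
  then have "F z = (1 - t) * (F z + g z \<bullet> (x - z)) + t * (F z + g z \<bullet> (y - z))"
    by (simp add: algebra_simps)
  also have "\<dots> \<le> (1 - t) * F x + t * F y"
    using t assms by (intro add_mono mult_left_mono) auto
  finally show "F ((1 - t) *\<^sub>R x + t *\<^sub>R y) \<le> (1 - t) * F x + t * F y"
    by (simp add: z_def)
qed auto

theorem proposition3p2:
  fixes n :: nat and a :: "nat \<Rightarrow> real" and p :: "real poly"
    and \<Phi> :: "real ^ 'd \<Rightarrow> real"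
    and \<Omega> :: "'w set"
    and f :: "real ^ 'd \<Rightarrow> real ^ 'd \<Rightarrow> 'w \<Rightarrow> real"
    and L :: "'w \<Rightarrow> real"
  assumes a_nonneg: "\<And>i. i \<le> n \<Longrightarrow> a i \<ge> 0"
    and p_eq: "p = (\<Sum>i\<le>n. monom (a i) i)"
    and \<Phi>_eq: "\<Phi> = (\<lambda>x. \<Sum>i\<le>n. a i * ((3 * real i + 7) / (real i + 2)) * norm x ^ (i + 2))"
  shows "convex_on UNIV \<Phi> \<and> \<Phi> differentiable_on UNIV \<and>
    (\<forall>x y. bregman \<Phi> y x \<ge> (poly p (norm x) + poly p (norm y)) / 2 * (norm (x - y))\<^sup>2) \<and>
    ((\<forall>\<xi>\<in>\<Omega>. L \<xi> \<ge> 0) \<longrightarrow>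
     (\<forall>\<xi>\<in>\<Omega>. \<forall>x y. x \<noteq> y \<longrightarrow>
        (f x x \<xi> - f x y \<xi>) / norm (x - y) \<le> L \<xi> * sqrt ((poly p (norm x) + poly p (norm y)) / 2)) \<longrightarrow>
     (\<forall>\<xi>\<in>\<Omega>. \<forall>x y. f x x \<xi> - f x y \<xi> \<le> L \<xi> * sqrt (bregman \<Phi> y x)))"
proof -
  define c where "c i = (3 * real i + 7) / (real i + 2)" for i
  have c: "c i \<ge> 2" for i by (simp add: c_def field_simps)
  define P where "P x y = (poly p (norm x) + poly p (norm y)) / 2" for x y :: "real ^ 'd"
  have poly_p: "poly p v = (\<Sum>i\<le>n. a i * v ^ i)" for v
    by (simp add: p_eq poly_sum poly_monom)
  have P_nonneg: "P x y \<ge> 0" for x y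
    unfolding P_def poly_p using a_nonneg by (intro divide_nonneg_nonneg add_nonneg_nonneg sum_nonneg) auto
  define G where "G x = (\<Sum>i\<le>n. (a i * c i) *\<^sub>R ((real i + 2) * norm x ^ i) *\<^sub>R x)" for x :: "real ^ 'd"
  have GD: "GDERIV \<Phi> x :> G x" for x
  proof -
    have "GDERIV (\<lambda>x. (a i * c i) * norm x ^ (i + 2)) x :> (a i * c i) *\<^sub>R ((real i + 2) * norm x ^ i) *\<^sub>R x" for i
      using has_derivative_mult_right[OF GDERIV_norm_power[of i x, unfolded gderiv_def], of "a i * c i"]
      by (simp add: gderiv_def mult.assoc)
    then show ?thesis unfolding \<Phi>_eq G_def c_def[symmetric] by (rule GDERIV_sum)
  qed
  have breg: "bregman \<Phi> y x = \<Phi> y - \<Phi> x - G x \<bullet> (y - x)" for x y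
    by (simp add: bregman_def gradient_eqI[OF GD])
  have bound: "P x y * (norm (x - y))\<^sup>2 \<le> bregman \<Phi> y x" for x y
  proof -
    have "P x y * (norm (x - y))\<^sup>2
        = (\<Sum>i\<le>n. a i * ((norm x ^ i + norm y ^ i) / 2 * (norm (x - y))\<^sup>2))"
      unfolding P_def poly_p
      by (simp add: sum.distrib[symmetric] sum_divide_distrib sum_distrib_right distrib_left
          distrib_right add_divide_distrib mult.assoc)
    also have "\<dots> \<le> (\<Sum>i\<le>n. a i * (c i * (norm y ^ (i + 2) - norm x ^ (i + 2)
        - (real i + 2) * norm x ^ i * (x \<bullet> (y - x)))))"
      using a_nonneg c by (intro sum_mono mult_left_mono norm_power_divergence_ge) auto
    also have "\<dots> = bregman \<Phi> y x"
      unfolding breg unfolding \<Phi>_eq G_def inner_sum_left sum_subtractf[symmetric] c_def[symmetric]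
      by (intro sum.cong) (simp_all add: algebra_simps)
    finally show ?thesis .
  qed
  have "convex_on UNIV \<Phi>"
  proof (rule convex_on_UNIV_if_above_tangents)
    fix x y
    have "0 \<le> P x y * (norm (x - y))\<^sup>2" using P_nonneg by simp
    then show "\<Phi> y \<ge> \<Phi> x + G x \<bullet> (y - x)" using bound[of x y] breg[of y x] by linarith
  qed
  moreover have "\<Phi> differentiable_on UNIV"
    using GD unfolding differentiable_on_def differentiable_def gderiv_def by blast
  moreover have "f x x \<xi> - f x y \<xi> \<le> L \<xi> * sqrt (bregman \<Phi> y x)"
    if "L \<xi> \<ge> 0"
      and lip: "x \<noteq> y \<Longrightarrow> (f x x \<xi> - f x y \<xi>) / norm (x - y) \<le> L \<xi> * sqrt (P x y)" for \<xi> x y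
  proof (cases "x = y")
    case True
    then show ?thesis by (simp add: bregman_def)
  next
    case False
    then have "f x x \<xi> - f x y \<xi> \<le> L \<xi> * sqrt (P x y) * norm (x - y)"
      using lip by (simp add: pos_divide_le_eq)
    also have "\<dots> = L \<xi> * sqrt (P x y * (norm (x - y))\<^sup>2)"
      by (simp add: real_sqrt_mult)
    also have "\<dots> \<le> L \<xi> * sqrt (bregman \<Phi> y x)"
      using bound that(1) by (intro mult_left_mono real_sqrt_le_mono)
    finally show ?thesis .
  qed
  ultimately show ?thesis using bound unfolding P_def by blast
qed

end
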